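(* Let $s,r\in\mathbb N_+$ and let $(a_{ij})_{i,j=1}^s,(b_i)_{i=1}^s$ and $(\tilde a_{mn})_{m,n=1}^r,(\tilde b_m)_{m=1}^r$ be real Runge--Kutta coefficients. Consider the splitting Runge--Kutta method for the stochastic nonlinear Schrödinger equation given, for $i=1,\dots,s$ and $m=1,\dots,r$, by \begin{align*} &P_i^m=p_0^m+\Delta x\sum_{j=1}^sa_{ij}V_j^m,\qquad Q_i^m=q_0^m+\Delta x\sum_{j=1}^sa_{ij}\mathcal W_j^m,\\ &\mathcal W_i^m=w_0^m+\Delta x\sum_{j=1}^sa_{ij}\,\delta_x\mathcal W_j^m,\qquad V_i^m=v_0^m+\Delta x\sum_{j=1}^sa_{ij}\,\delta_xV_j^m,\\ &\overline p_1^m=p_0^m+\Delta x\sum_{i=1}^sb_iV_i^m,\qquad \overline q_1^m=q_0^m+\Delta x\sum_{i=1}^sb_i\mathcal W_i^m,\\ &\overline w_1^m=w_0^m+\Delta x\sum_{i=1}^sb_i\,\delta_x\mathcal W_i^m,\qquad \overline v_1^m=v_0^m+\Delta x\sum_{i=1}^sb_i\,\delta_xV_i^m,\\ &Q_i^m=q_i^0+\Delta t\sum_{n=1}^r\tilde a_{mn}\Big(\delta_xV_i^n+\big((P_i^n)^2+(Q_i^n)^2\big)P_i^n\Big),\\ &P_i^m=p_i^0+\Delta t\sum_{n=1}^r\tilde a_{mn}\Big(-\delta_x\mathcal W_i^n-\big((P_i^n)^2+(Q_i^n)^2\big)Q_i^n\Big),\\ &\overline q_i^1=q_i^0+\Delta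 t\sum_{m=1}^r\tilde b_m\Big(\delta_xV_i^m+\big((P_i^m)^2+(Q_i^m)^2\big)P_i^m\Big),\\ &\overline p_i^1=p_i^0+\Delta t\sum_{m=1}^r\tilde b_m\Big(-\delta_x\mathcal W_i^m-\big((P_i^m)^2+(Q_i^m)^2\big)Q_i^m\Big),\\ &p_1^m=\overline p_1^m,\quad q_1^m=\overline q_1^m,\quad v_1^m=\overline v_1^m,\quad w_1^m=\overline w_1^m,\\ &q_i^1=\overline q_i^1-\overline p_i^1\,\Delta W_i^1,\qquad p_i^1=\overline p_i^1+q_i^1\,\Delta W_i^1 . \end{align*} Assume the symplectic condition $$b_ib_j-b_ia_{ij}-b_ja_{ji}=0\quad(1\le i,j\le s),\qquad \tilde b_m\tilde b_n-\tilde b_m\tilde a_{mn}-\tilde b_n\tilde a_{nm}=0\quad(1\le m,n\le r).$$ Then the method preserves, almost surely, the discrete multi-symplectic conservation law $$\sum_{i=1}^s\frac{b_i}{\Delta t}\big(\mathrm dq_i^1\wedge\mathrm dp_i^1-\mathrm dq_i^0\wedge\mathrm dp_i^0\big)+\sum_{m=1}^r\frac{\tilde b_m}{\Delta x}\big(\mathrm dp_1^m\wedge\mathrm dv_1^m-\mathrm dp_0^m\wedge\mathrm dv_0^m+\mathrm dq_1^m\wedge\mathrm dw_1^m-\mathrm dq_0^m\wedge\mathrm dw_0^m\big)=0 .$$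
   Context: The stochastic nonlinear Schrödinger equation is $\mathbf i\,du+u_{xx}\,dt+|u|^2u\,dt=u\circ dW(t)$; with $u=p+\mathbf iq$, $v=p_x$, $w=q_x$ it reads $dq-v_x\,dt=(p^2+q^2)p\,dt-p\circ dW$, $dp+w_x\,dt=-(p^2+q^2)q\,dt+q\circ dW$, $p_x=v$, $q_x=w$. $W$ is a real $L^2$-valued $Q$-Wiener process with trace-class $Q$. The method treats one space-time cell $[0,\Delta x]\times[0,\Delta t]$: the deterministic part is discretized by Runge--Kutta methods in space and time, the remaining stochastic part ($dq=-p\circ dW$, $dp=q\circ dW$) by the symplectic Euler method. All quantities are real numbers for each realization of the noise. Stage quantities $P_i^m,Q_i^m,V_i^m,\mathcal W_i^m$ approximate $p,q,v,w$ at $(c_i\Delta x,\tilde c_m\Delta t)$, $c_i=\sum_ja_{ij}$, $\tilde c_m=\sum_n\tilde a_{mn}$; $\delta_xV_i^m,\delta_x\mathcal W_i^m$ are the stage quantities discretizing $\partial_xv,\partial_xw$. Superscripts $0,1$ on $p_i,q_i$ refer to times $0,\Delta t$ at $x=c_i\Delta x$; subscripts $0,1$ on $p^m,q^m,v^m,w^m$ refer to $x=0,\Delta x$ at time $\tilde c_m\Delta t$ (quantities indexed by a spatial stage and by a temporal stage are different families). $\Delta W_i^1=W(c_i\Delta x,\Delta t)-W(c_i\Delta x,0)$. $\mathrm d$ (roman) is the exterior derivative: for a fixed realization of the noise, all numerical quantities are regarded as differentiable functions of parameters (e.g. the data), so their differentials satisfy the linearized scheme and noise increments carry no differential. *)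

theory Defs
  imports "HOL-Probability.Probability"
begin

text \<open>Real \<open>L\<^sup>2(D)\<close> is represented by functions, so that point evaluations of the noise make sense;
  elements are to be read modulo equality almost everywhere.\<close>

definition L2 :: "real set \<Rightarrow> (real \<Rightarrow> real) set" where
  "L2 D = {f \<in> borel_measurable (lebesgue_on D). integrable (lebesgue_on D) (\<lambda>x. (f x)\<^sup>2)}"

definition L2_inner :: "real set \<Rightarrow> (real \<Rightarrow> real) \<Rightarrow> (real \<Rightarrow> real) \<Rightarrow> real" where
  "L2_inner D f g = (LINT x|lebesgue_on D. f x * g x)"

definition L2_norm :: "real set \<Rightarrow> (real \<Rightarrow> real) \<Rightarrow> real" where
  "L2_norm D f = sqrt (L2_inner D f f)"

definition L2_borel :: "real set \<Rightarrow> (real \<Rightarrow> real) measure" where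
  "L2_borel D = sigma (L2 D)
     {G. G \<subseteq> L2 D \<and>
         (\<forall>f\<in>G. \<exists>\<epsilon>>0. \<forall>g\<in>L2 D. L2_norm D (\<lambda>x. g x - f x) < \<epsilon> \<longrightarrow> g \<in> G)}"

definition L2_orthonormal_basis :: "real set \<Rightarrow> (nat \<Rightarrow> real \<Rightarrow> real) \<Rightarrow> bool" where
  "L2_orthonormal_basis D e \<longleftrightarrow>
     (\<forall>k. e k \<in> L2 D) \<and>
     (\<forall>k l. L2_inner D (e k) (e l) = (if k = l then 1 else 0)) \<and>
     (\<forall>f\<in>L2 D. (\<forall>k. L2_inner D f (e k) = 0) \<longrightarrow> (AE x in lebesgue_on D. f x = 0))"

text \<open>Boundedness makes \<open>Q\<close> respect equality almost everywhere. For a nonnegative symmetric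
  operator, summability of the diagonal in one orthonormal basis is the trace-class property.\<close>

definition trace_class_covariance ::
    "real set \<Rightarrow> ((real \<Rightarrow> real) \<Rightarrow> real \<Rightarrow> real) \<Rightarrow> bool" where
  "trace_class_covariance D Q \<longleftrightarrow>
     (\<forall>f\<in>L2 D. Q f \<in> L2 D) \<and>
     (\<forall>f\<in>L2 D. \<forall>g\<in>L2 D. \<forall>\<alpha> \<beta>.
        AE x in lebesgue_on D. Q (\<lambda>y. \<alpha> * f y + \<beta> * g y) x = \<alpha> * Q f x + \<beta> * Q g x) \<and>
     (\<exists>C. \<forall>f\<in>L2 D. L2_norm D (Q f) \<le> C * L2_norm D f) \<and>
     (\<forall>f\<in>L2 D. \<forall>g\<in>L2 D. L2_inner D (Q f) g = L2_inner D f (Q g)) \<and>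
     (\<forall>f\<in>L2 D. 0 \<le> L2_inner D (Q f) f) \<and>
     (\<exists>e. L2_orthonormal_basis D e \<and> summable (\<lambda>k. L2_inner D (Q (e k)) (e k)))"

definition centered_normal :: "real \<Rightarrow> real measure" where
  "centered_normal v =
     (if v = 0 then return borel 0 else density lborel (normal_density 0 (sqrt v)))"

text \<open>\<open>W x t \<omega>\<close> is the value at position \<open>x\<close> and time \<open>t\<close>. The law of an increment is
  \<open>N(0, (t - s) Q)\<close> on \<open>L\<^sup>2(D)\<close>, expressed through all continuous linear functionals.\<close>

definition Q_Wiener_process ::
    "'w measure \<Rightarrow> real set \<Rightarrow> ((real \<Rightarrow> real) \<Rightarrow> real \<Rightarrow> real) \<Rightarrow>
     (real \<Rightarrow> real \<Rightarrow> 'w \<Rightarrow> real) \<Rightarrow> bool" where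
  "Q_Wiener_process M D Q W \<longleftrightarrow>
     prob_space M \<and> trace_class_covariance D Q \<and>
     (\<forall>x\<in>D. \<forall>t\<ge>0. W x t \<in> borel_measurable M) \<and>
     (\<forall>t\<ge>0. (\<lambda>\<omega> x. W x t \<omega>) \<in> measurable M (L2_borel D)) \<and>
     (AE \<omega> in M. AE x in lebesgue_on D. W x 0 \<omega> = 0) \<and>
     (AE \<omega> in M. \<forall>t\<ge>0.
        ((\<lambda>u. L2_norm D (\<lambda>x. W x u \<omega> - W x t \<omega>)) \<longlongrightarrow> 0) (at t within {0..})) \<and>
     (\<forall>n (t :: nat \<Rightarrow> real). 0 \<le> t 0 \<longrightarrow> (\<forall>k<n. t k < t (Suc k)) \<longrightarrow>
        prob_space.indep_vars M (\<lambda>_. L2_borel D)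
          (\<lambda>k \<omega> x. W x (t (Suc k)) \<omega> - W x (t k) \<omega>) {..<n}) \<and>
     (\<forall>u t. 0 \<le> u \<longrightarrow> u < t \<longrightarrow> (\<forall>h\<in>L2 D.
        distr M borel (\<lambda>\<omega>. L2_inner D (\<lambda>x. W x t \<omega> - W x u \<omega>) h) =
        centered_normal ((t - u) * L2_inner D (Q h) h)))"

text \<open>\<open>'p\<close> is the space of the parameters on which the numerical quantities depend. Fields with
  prefix \<open>st\<close> are indexed by a spatial stage and a temporal stage, in this order. The prefix \<open>x0\<close>,
  \<open>x1\<close> means \<open>x = 0\<close>, \<open>x = \<Delta>x\<close> (indexed by a temporal stage), \<open>t0\<close>, \<open>t1\<close> means \<open>t = 0\<close>, \<open>t = \<Delta>t\<close>
  (indexed by a spatial stage), and \<open>bar\<close> marks the overlined quantities.\<close>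

record 'p nls_cell =
  stP :: "nat \<Rightarrow> nat \<Rightarrow> 'p \<Rightarrow> real"
  stQ :: "nat \<Rightarrow> nat \<Rightarrow> 'p \<Rightarrow> real"
  stV :: "nat \<Rightarrow> nat \<Rightarrow> 'p \<Rightarrow> real"
  stW :: "nat \<Rightarrow> nat \<Rightarrow> 'p \<Rightarrow> real"
  stDV :: "nat \<Rightarrow> nat \<Rightarrow> 'p \<Rightarrow> real"
  stDW :: "nat \<Rightarrow> nat \<Rightarrow> 'p \<Rightarrow> real"
  x0p :: "nat \<Rightarrow> 'p \<Rightarrow> real"
  x0q :: "nat \<Rightarrow> 'p \<Rightarrow> real"
  x0v :: "nat \<Rightarrow> 'p \<Rightarrow> real"
  x0w :: "nat \<Rightarrow> 'p \<Rightarrow> real"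
  barx1p :: "nat \<Rightarrow> 'p \<Rightarrow> real"
  barx1q :: "nat \<Rightarrow> 'p \<Rightarrow> real"
  barx1v :: "nat \<Rightarrow> 'p \<Rightarrow> real"
  barx1w :: "nat \<Rightarrow> 'p \<Rightarrow> real"
  x1p :: "nat \<Rightarrow> 'p \<Rightarrow> real"
  x1q :: "nat \<Rightarrow> 'p \<Rightarrow> real"
  x1v :: "nat \<Rightarrow> 'p \<Rightarrow> real"
  x1w :: "nat \<Rightarrow> 'p \<Rightarrow> real"
  t0p :: "nat \<Rightarrow> 'p \<Rightarrow> real"
  t0q :: "nat \<Rightarrow> 'p \<Rightarrow> real"
  bart1p :: "nat \<Rightarrow> 'p \<Rightarrow> real"
  bart1q :: "nat \<Rightarrow> 'p \<Rightarrow> real"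
  t1p :: "nat \<Rightarrow> 'p \<Rightarrow> real"
  t1q :: "nat \<Rightarrow> 'p \<Rightarrow> real"

definition differentiable_cell ::
    "nat \<Rightarrow> nat \<Rightarrow> 'p::real_normed_vector nls_cell \<Rightarrow> 'p set \<Rightarrow> bool" where
  "differentiable_cell s r z U \<longleftrightarrow>
     (\<forall>i\<in>{1..s}. \<forall>m\<in>{1..r}. \<forall>f\<in>{stP, stQ, stV, stW, stDV, stDW}. f z i m differentiable_on U) \<and>
     (\<forall>m\<in>{1..r}. \<forall>f\<in>{x0p, x0q, x0v, x0w, barx1p, barx1q, barx1v, barx1w, x1p, x1q, x1v, x1w}.
        f z m differentiable_on U) \<and>
     (\<forall>i\<in>{1..s}. \<forall>f\<in>{t0p, t0q, bart1p, bart1q, t1p, t1q}. f z i differentiable_on U)"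

text \<open>The method for one realization of the noise: \<open>a\<close>, \<open>b\<close> are the coefficients in space,
  \<open>a'\<close>, \<open>b'\<close> those in time, and \<open>dW i\<close> is the noise increment at \<open>x = c\<^sub>i \<Delta>x\<close>.\<close>

definition splitting_RK_method ::
    "nat \<Rightarrow> nat \<Rightarrow> (nat \<Rightarrow> nat \<Rightarrow> real) \<Rightarrow> (nat \<Rightarrow> real) \<Rightarrow> (nat \<Rightarrow> nat \<Rightarrow> real) \<Rightarrow> (nat \<Rightarrow> real) \<Rightarrow>
     real \<Rightarrow> real \<Rightarrow> (nat \<Rightarrow> real) \<Rightarrow> 'p nls_cell \<Rightarrow> 'p \<Rightarrow> bool" where
  "splitting_RK_method s r a b a' b' \<Delta>x \<Delta>t dW z \<theta> \<longleftrightarrow>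
     (\<forall>i\<in>{1..s}. \<forall>m\<in>{1..r}.
        stP z i m \<theta> = x0p z m \<theta> + \<Delta>x * (\<Sum>j=1..s. a i j * stV z j m \<theta>) \<and>
        stQ z i m \<theta> = x0q z m \<theta> + \<Delta>x * (\<Sum>j=1..s. a i j * stW z j m \<theta>) \<and>
        stW z i m \<theta> = x0w z m \<theta> + \<Delta>x * (\<Sum>j=1..s. a i j * stDW z j m \<theta>) \<and>
        stV z i m \<theta> = x0v z m \<theta> + \<Delta>x * (\<Sum>j=1..s. a i j * stDV z j m \<theta>)) \<and>
     (\<forall>m\<in>{1..r}.
        barx1p z m \<theta> = x0p z m \<theta> + \<Delta>x * (\<Sum>i=1..s. b i * stV z i m \<theta>) \<and>
        barx1q z m \<theta> = x0q z m \<theta> + \<Delta>x * (\<Sum>i=1..s. b i * stW z i m \<theta>) \<and>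
        barx1w z m \<theta> = x0w z m \<theta> + \<Delta>x * (\<Sum>i=1..s. b i * stDW z i m \<theta>) \<and>
        barx1v z m \<theta> = x0v z m \<theta> + \<Delta>x * (\<Sum>i=1..s. b i * stDV z i m \<theta>)) \<and>
     (\<forall>i\<in>{1..s}. \<forall>m\<in>{1..r}.
        stQ z i m \<theta> = t0q z i \<theta> + \<Delta>t * (\<Sum>n=1..r. a' m n *
          (stDV z i n \<theta> + ((stP z i n \<theta>)\<^sup>2 + (stQ z i n \<theta>)\<^sup>2) * stP z i n \<theta>)) \<and>
        stP z i m \<theta> = t0p z i \<theta> + \<Delta>t * (\<Sum>n=1..r. a' m n *
          (- stDW z i n \<theta> - ((stP z i n \<theta>)\<^sup>2 + (stQ z i n \<theta>)\<^sup>2) * stQ z i n \<theta>))) \<and>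
     (\<forall>i\<in>{1..s}.
        bart1q z i \<theta> = t0q z i \<theta> + \<Delta>t * (\<Sum>m=1..r. b' m *
          (stDV z i m \<theta> + ((stP z i m \<theta>)\<^sup>2 + (stQ z i m \<theta>)\<^sup>2) * stP z i m \<theta>)) \<and>
        bart1p z i \<theta> = t0p z i \<theta> + \<Delta>t * (\<Sum>m=1..r. b' m *
          (- stDW z i m \<theta> - ((stP z i m \<theta>)\<^sup>2 + (stQ z i m \<theta>)\<^sup>2) * stQ z i m \<theta>))) \<and>
     (\<forall>m\<in>{1..r}.
        x1p z m \<theta> = barx1p z m \<theta> \<and> x1q z m \<theta> = barx1q z m \<theta> \<and>
        x1v z m \<theta> = barx1v z m \<theta> \<and> x1w z m \<theta> = barx1w z m \<theta>) \<and>
     (\<forall>i\<in>{1..s}.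
        t1q z i \<theta> = bart1q z i \<theta> - bart1p z i \<theta> * dW i \<and>
        t1p z i \<theta> = bart1p z i \<theta> + t1q z i \<theta> * dW i)"

text \<open>One-forms and two-forms on \<open>'p\<close> at a point are functions of one and two tangent vectors;
  \<open>d_wedge_d f g \<theta>\<close> is the two-form \<open>df \<and> dg\<close> at \<open>\<theta>\<close>.\<close>

definition ext_d :: "('p::real_normed_vector \<Rightarrow> real) \<Rightarrow> 'p \<Rightarrow> 'p \<Rightarrow> real" where
  "ext_d f \<theta> = frechet_derivative f (at \<theta>)"

definition wedge :: "('p \<Rightarrow> real) \<Rightarrow> ('p \<Rightarrow> real) \<Rightarrow> 'p \<Rightarrow> 'p \<Rightarrow> real" where
  "wedge \<alpha> \<beta> \<xi> \<eta> = \<alpha> \<xi> * \<beta> \<eta> - \<alpha> \<eta> * \<beta> \<xi>"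

definition d_wedge_d ::
    "('p::real_normed_vector \<Rightarrow> real) \<Rightarrow> ('p \<Rightarrow> real) \<Rightarrow> 'p \<Rightarrow> 'p \<Rightarrow> 'p \<Rightarrow> real" where
  "d_wedge_d f g \<theta> = wedge (ext_d f \<theta>) (ext_d g \<theta>)"

end

theory Submission
  imports Defs
begin

text \<open>The differentials satisfy the linearized scheme. A symplectic Runge--Kutta method integrates
  bilinear forms exactly by its own quadrature rule, so the wedge product of the differentials of
  two components changes by \<open>h \<Sum>\<^sub>i b\<^sub>i (dY\<^sub>i \<and> dG\<^sub>i + dF\<^sub>i \<and> dZ\<^sub>i)\<close>. In space this yields the
  terms \<open>dP \<and> d\<delta>\<^sub>xV + dQ \<and> d\<delta>\<^sub>xW\<close>, in time their negatives, because the cubic term is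
  Hamiltonian and drops out. The stochastic symplectic Euler step is a composition of two shears,
  each preserving \<open>dq \<and> dp\<close>.\<close>

section \<open>Symplectic Runge-Kutta methods, bilinear forms and wedge products\<close>

lemma symplectic_RK_product:
  fixes a :: "'i \<Rightarrow> 'i \<Rightarrow> 'a::comm_ring_1" and b F G Y Z :: "'i \<Rightarrow> 'a"
  assumes symplectic: "\<And>i j. i \<in> I \<Longrightarrow> j \<in> I \<Longrightarrow> b i * b j - b i * a i j - b j * a j i = 0"
    and Y: "\<And>i. i \<in> I \<Longrightarrow> Y i = y0 + h * (\<Sum>j\<in>I. a i j * F j)"
    and Z: "\<And>i. i \<in> I \<Longrightarrow> Z i = z0 + h * (\<Sum>j\<in>I. a i j * G j)"
    and y1: "y1 = y0 + h * (\<Sum>i\<in>I. b i * F i)"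
    and z1: "z1 = z0 + h * (\<Sum>i\<in>I. b i * G i)"
  shows "y1 * z1 - y0 * z0 = h * (\<Sum>i\<in>I. b i * (Y i * G i + F i * Z i))"
proof -
  \<comment> \<open>Expanding \<open>y1 * z1\<close> leaves this product as the term quadratic in
    \<open>h\<close>. The symplectic condition splits its weights \<open>b i * b j\<close> so that
    each half is the correction by which a stage value differs from \<open>z0\<close> or
    \<open>y0\<close>.\<close>
  have "(\<Sum>i\<in>I. b i * F i) * (\<Sum>j\<in>I. b j * G j) = (\<Sum>i\<in>I. \<Sum>j\<in>I. (b i * b j) * (F i * G j))"
    by (simp add: sum_product mult_ac)
  also have "\<dots> = (\<Sum>i\<in>I. \<Sum>j\<in>I. (b i * a i j + b j * a j i) * (F i * G j))"
    using symplectic by (intro sum.cong refl arg_cong2[where f = "(*)"]) (simp add: algebra_simps)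
  also have "\<dots> = (\<Sum>i\<in>I. b i * (F i * (\<Sum>j\<in>I. a i j * G j)))
      + (\<Sum>i\<in>I. \<Sum>j\<in>I. b j * a j i * (F i * G j))"
    by (simp add: algebra_simps sum.distrib sum_distrib_left)
  also have "(\<Sum>i\<in>I. \<Sum>j\<in>I. b j * a j i * (F i * G j)) = (\<Sum>i\<in>I. b i * ((\<Sum>j\<in>I. a i j * F j) * G i))"
    by (subst sum.swap) (simp add: sum_distrib_left sum_distrib_right mult_ac)
  finally have quad: "(\<Sum>i\<in>I. b i * F i) * (\<Sum>j\<in>I. b j * G j)
      = (\<Sum>i\<in>I. b i * (F i * (\<Sum>j\<in>I. a i j * G j))) + (\<Sum>i\<in>I. b i * ((\<Sum>j\<in>I. a i j * F j) * G i))" .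
  \<comment> \<open>Inserting the stage equations into the quadrature sum produces exactly the two
    corrections collected in \<open>quad\<close>.\<close>
  have "(\<Sum>i\<in>I. b i * (Y i * G i + F i * Z i)) =
      (\<Sum>i\<in>I. y0 * (b i * G i) + z0 * (b i * F i)
        + h * (b i * (F i * (\<Sum>j\<in>I. a i j * G j)) + b i * ((\<Sum>j\<in>I. a i j * F j) * G i)))"
    by (intro sum.cong refl) (simp add: Y Z algebra_simps)
  also have "\<dots> = y0 * (\<Sum>i\<in>I. b i * G i) + z0 * (\<Sum>i\<in>I. b i * F i)
      + h * ((\<Sum>i\<in>I. b i * F i) * (\<Sum>j\<in>I. b j * G j))"
    unfolding quad by (simp only: sum.distrib sum_distrib_left distrib_left)
  finally show ?thesis
    unfolding y1 z1 by (simp add: algebra_simps)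
qed

text \<open>The two factors of the product rule may be evaluated at different tangent vectors, since
  each satisfies its Runge-Kutta relation at every vector. Antisymmetrizing in \<xi> and \<eta> then
  gives the wedge product.\<close>

lemma symplectic_RK_wedge:
  fixes F G Y Z :: "'i \<Rightarrow> 'p \<Rightarrow> real"
  assumes symplectic: "\<And>i j. i \<in> I \<Longrightarrow> j \<in> I \<Longrightarrow> b i * b j - b i * a i j - b j * a j i = 0"
    and Y: "\<And>i \<xi>. i \<in> I \<Longrightarrow> Y i \<xi> = y0 \<xi> + h * (\<Sum>j\<in>I. a i j * F j \<xi>)"
    and Z: "\<And>i \<xi>. i \<in> I \<Longrightarrow> Z i \<xi> = z0 \<xi> + h * (\<Sum>j\<in>I. a i j * G j \<xi>)"
    and y1: "\<And>\<xi>. y1 \<xi> = y0 \<xi> + h * (\<Sum>i\<in>I. b i * F i \<xi>)"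
    and z1: "\<And>\<xi>. z1 \<xi> = z0 \<xi> + h * (\<Sum>i\<in>I. b i * G i \<xi>)"
  shows "wedge y1 z1 \<xi> \<eta> - wedge y0 z0 \<xi> \<eta>
    = h * (\<Sum>i\<in>I. b i * (wedge (Y i) (G i) \<xi> \<eta> + wedge (F i) (Z i) \<xi> \<eta>))"
proof -
  have prod: "y1 u * z1 v - y0 u * z0 v = h * (\<Sum>i\<in>I. b i * (Y i u * G i v + F i u * Z i v))" for u v
    by (rule symplectic_RK_product[OF symplectic]) (simp_all add: Y Z y1 z1)
  have "wedge y1 z1 \<xi> \<eta> - wedge y0 z0 \<xi> \<eta>
      = (y1 \<xi> * z1 \<eta> - y0 \<xi> * z0 \<eta>) - (y1 \<eta> * z1 \<xi> - y0 \<eta> * z0 \<xi>)"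
    by (simp add: wedge_def)
  also have "\<dots> = h * (\<Sum>i\<in>I. b i * (Y i \<xi> * G i \<eta> + F i \<xi> * Z i \<eta>)
      - b i * (Y i \<eta> * G i \<xi> + F i \<eta> * Z i \<xi>))"
    unfolding prod by (simp only: sum_subtractf right_diff_distrib)
  also have "\<dots> = h * (\<Sum>i\<in>I. b i * (wedge (Y i) (G i) \<xi> \<eta> + wedge (F i) (Z i) \<xi> \<eta>))"
    by (intro arg_cong2[where f = "(*)"] sum.cong refl) (simp add: wedge_def algebra_simps)
  finally show ?thesis .
qed

lemma wedge_same [simp]: "wedge \<alpha> \<alpha> \<xi> \<eta> = 0"
  by (simp add: wedge_def)

text \<open>The update of \<open>p\<close> uses the new \<open>q1\<close>, so each substep adds to
  one component a multiple of the other, whose wedge with itself vanishes. The factor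
  \<open>w\<close> is constant in \<xi> because noise increments carry no differential.\<close>

lemma wedge_symplectic_Euler:
  assumes "\<And>\<xi>. q1 \<xi> = q \<xi> - p \<xi> * w" and "\<And>\<xi>. p1 \<xi> = p \<xi> + q1 \<xi> * w"
  shows "wedge q1 p1 \<xi> \<eta> = wedge q p \<xi> \<eta>"
  unfolding wedge_def assms by (simp add: algebra_simps)

section \<open>Linearization of the scheme\<close>

lemma has_derivative_ext_d:
  "f differentiable at \<theta> \<Longrightarrow> (f has_derivative ext_d f \<theta>) (at \<theta>)"
  unfolding ext_d_def by (simp add: frechet_derivative_works)

text \<open>A derivative depends only on values near \<theta>, so an equation of the scheme valid on
  an open parameter set can be differentiated.\<close>

lemma ext_d_eqI:
  assumes "(g has_derivative D) (at \<theta>)" and "open U" and "\<theta> \<in> U" and "\<And>x. x \<in> U \<Longrightarrow> f x = g x"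
  shows "ext_d f \<theta> = D"
proof -
  have "(f has_derivative D) (at \<theta>)"
    using assms(1-3) by (rule has_derivative_transform_within_open) (simp add: assms(4))
  then show ?thesis
    unfolding ext_d_def by (rule frechet_derivative_at[symmetric])
qed

lemma ext_d_RK:
  assumes "open U" and "\<theta> \<in> U"
    and "\<And>x. x \<in> U \<Longrightarrow> f x = g x + h * (\<Sum>j\<in>I. c j * F j x)"
    and "g differentiable at \<theta>" and "\<And>j. j \<in> I \<Longrightarrow> F j differentiable at \<theta>"
  shows "ext_d f \<theta> \<xi> = ext_d g \<theta> \<xi> + h * (\<Sum>j\<in>I. c j * ext_d (F j) \<theta> \<xi>)"
proof -
  have "((\<lambda>x. g x + h * (\<Sum>j\<in>I. c j * F j x)) has_derivative
      (\<lambda>\<xi>. ext_d g \<theta> \<xi> + h * (\<Sum>j\<in>I. c j * ext_d (F j) \<theta> \<xi>))) (at \<theta>)"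
    using assms(4,5) by (intro has_derivative_add has_derivative_mult_right has_derivative_sum
      has_derivative_ext_d)
  then have "ext_d f \<theta> = (\<lambda>\<xi>. ext_d g \<theta> \<xi> + h * (\<Sum>j\<in>I. c j * ext_d (F j) \<theta> \<xi>))"
    using assms(1-3) by (rule ext_d_eqI)
  then show ?thesis by simp
qed

text \<open>The cubic terms are, up to sign, the partial derivatives of
  \<open>(p^2 + q^2)^2 / 4\<close>. The coefficients here are its second derivatives, and the mixed
  one, \<open>2 * p * q\<close>, occurs in both formulas.\<close>

lemma has_derivative_cubic_terms:
  fixes p q v w :: "'p::real_normed_vector \<Rightarrow> real"
  assumes "p differentiable at \<theta>" "q differentiable at \<theta>" "v differentiable at \<theta>" "w differentiable at \<theta>"
  shows "((\<lambda>x. v x + ((p x)\<^sup>2 + (q x)\<^sup>2) * p x) has_derivative (\<lambda>\<xi>. ext_d v \<theta> \<xi>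
      + (3 * (p \<theta>)\<^sup>2 + (q \<theta>)\<^sup>2) * ext_d p \<theta> \<xi> + 2 * p \<theta> * q \<theta> * ext_d q \<theta> \<xi>)) (at \<theta>)"
    and "((\<lambda>x. - w x - ((p x)\<^sup>2 + (q x)\<^sup>2) * q x) has_derivative (\<lambda>\<xi>. - ext_d w \<theta> \<xi>
      - ((p \<theta>)\<^sup>2 + 3 * (q \<theta>)\<^sup>2) * ext_d q \<theta> \<xi> - 2 * p \<theta> * q \<theta> * ext_d p \<theta> \<xi>)) (at \<theta>)"
  by (rule derivative_eq_intros assms[THEN has_derivative_ext_d] refl
      | simp add: fun_eq_iff algebra_simps power2_eq_square)+

text \<open>The left-hand side is, for one stage, the rate of change of \<open>dq \<and> dp\<close> in time.\<close>

lemma wedge_cubic_terms: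
  fixes p q v w :: "'p::real_normed_vector \<Rightarrow> real"
  assumes "p differentiable at \<theta>" "q differentiable at \<theta>" "v differentiable at \<theta>" "w differentiable at \<theta>"
  shows "d_wedge_d q (\<lambda>x. - w x - ((p x)\<^sup>2 + (q x)\<^sup>2) * q x) \<theta> \<xi> \<eta>
      + d_wedge_d (\<lambda>x. v x + ((p x)\<^sup>2 + (q x)\<^sup>2) * p x) p \<theta> \<xi> \<eta>
    = - (d_wedge_d p v \<theta> \<xi> \<eta> + d_wedge_d q w \<theta> \<xi> \<eta>)"
proof -
  note d = has_derivative_cubic_terms[OF assms, THEN ext_d_eqI, OF open_UNIV UNIV_I refl]
  \<comment> \<open>The diagonal second derivatives meet \<open>dp\<close> with \<open>dp\<close> or
    \<open>dq\<close> with \<open>dq\<close> and vanish; the two mixed terms cancel by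
    symmetry.\<close>
  show ?thesis
    unfolding d_wedge_d_def d wedge_def by (simp add: algebra_simps)
qed

section \<open>The conservation law on one cell for a fixed realization\<close>

lemma splitting_RK_multisymplectic:
  fixes z :: "'p::real_normed_vector nls_cell"
  assumes "\<Delta>x \<noteq> 0" and "\<Delta>t \<noteq> 0" and U: "open U" "\<theta> \<in> U"
    and cell: "differentiable_cell s r z U"
    and RK_method: "\<And>x. x \<in> U \<Longrightarrow> splitting_RK_method s r a b a' b' \<Delta>x \<Delta>t dW z x"
    and symplectic_space:
      "\<And>i j. i \<in> {1..s} \<Longrightarrow> j \<in> {1..s} \<Longrightarrow> b i * b j - b i * a i j - b j * a j i = 0"
    and symplectic_time:
      "\<And>m n. m \<in> {1..r} \<Longrightarrow> n \<in> {1..r} \<Longrightarrow> b' m * b' n - b' m * a' m n - b' n * a' n m = 0"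
  shows "(\<Sum>i=1..s. b i / \<Delta>t *
      (d_wedge_d (t1q z i) (t1p z i) \<theta> \<xi> \<eta> - d_wedge_d (t0q z i) (t0p z i) \<theta> \<xi> \<eta>)) +
    (\<Sum>m=1..r. b' m / \<Delta>x *
      (d_wedge_d (x1p z m) (x1v z m) \<theta> \<xi> \<eta> - d_wedge_d (x0p z m) (x0v z m) \<theta> \<xi> \<eta>
       + d_wedge_d (x1q z m) (x1w z m) \<theta> \<xi> \<eta> - d_wedge_d (x0q z m) (x0w z m) \<theta> \<xi> \<eta>)) = 0"
proof -
  have at: "f differentiable at \<theta>" if "f differentiable_on U" for f :: "'p \<Rightarrow> real"
    using that U by (auto simp: differentiable_on_eq_differentiable_at)
  have diff_stage: "stP z i m differentiable at \<theta>" "stQ z i m differentiable at \<theta>"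
      "stV z i m differentiable at \<theta>" "stW z i m differentiable at \<theta>"
      "stDV z i m differentiable at \<theta>" "stDW z i m differentiable at \<theta>"
    if "i \<in> {1..s}" "m \<in> {1..r}" for i m
    using cell that unfolding differentiable_cell_def by (auto intro!: at)
  have diff_x: "x0p z m differentiable at \<theta>" "x0q z m differentiable at \<theta>"
      "x0v z m differentiable at \<theta>" "x0w z m differentiable at \<theta>"
    if "m \<in> {1..r}" for m
    using cell that unfolding differentiable_cell_def by (auto intro!: at)
  have diff_t: "t0p z i differentiable at \<theta>" "t0q z i differentiable at \<theta>"
      "bart1p z i differentiable at \<theta>" "bart1q z i differentiable at \<theta>" "t1q z i differentiable at \<theta>"
    if "i \<in> {1..s}" for i
    using cell that unfolding differentiable_cell_def by (auto intro!: at)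
  define F where "F i m x = stDV z i m x + ((stP z i m x)\<^sup>2 + (stQ z i m x)\<^sup>2) * stP z i m x" for i m x
  define G where "G i m x = - stDW z i m x - ((stP z i m x)\<^sup>2 + (stQ z i m x)\<^sup>2) * stQ z i m x" for i m x
  have diff_F: "F i m differentiable at \<theta>" and diff_G: "G i m differentiable at \<theta>"
    if "i \<in> {1..s}" "m \<in> {1..r}" for i m
    using has_derivative_cubic_terms[OF diff_stage(1,2,5,6)[OF that]]
    unfolding F_def[abs_def] G_def[abs_def] by (blast intro: differentiableI)+
  note scheme = RK_method[unfolded splitting_RK_method_def]

  \<comment> \<open>The two-form at stage \<open>(i, m)\<close> through which space and time
    balance: it occurs with opposite signs in \<open>space\<close> and \<open>time\<close>.\<close>
  let ?E = "\<lambda>i m. d_wedge_d (stP z i m) (stDV z i m) \<theta> \<xi> \<eta> + d_wedge_d (stQ z i m) (stDW z i m) \<theta> \<xi> \<eta>"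

  have space: "d_wedge_d (x1p z m) (x1v z m) \<theta> \<xi> \<eta> - d_wedge_d (x0p z m) (x0v z m) \<theta> \<xi> \<eta>
      + d_wedge_d (x1q z m) (x1w z m) \<theta> \<xi> \<eta> - d_wedge_d (x0q z m) (x0w z m) \<theta> \<xi> \<eta>
    = \<Delta>x * (\<Sum>i=1..s. b i * ?E i m)" if m: "m \<in> {1..r}" for m
  proof -
    note diff = diff_stage[OF _ m] diff_x[OF m]
    \<comment> \<open>Since \<open>p\<close> has slope \<open>V\<close> and \<open>v\<close> has
      slope \<open>DV\<close>, the quadrature also contains \<open>dV\<close> wedge
      \<open>dV\<close>, which is zero; likewise for \<open>q\<close> and \<open>w\<close>
      below.\<close>
    have "d_wedge_d (x1p z m) (x1v z m) \<theta> \<xi> \<eta> - d_wedge_d (x0p z m) (x0v z m) \<theta> \<xi> \<eta>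
      = \<Delta>x * (\<Sum>i=1..s. b i * (d_wedge_d (stP z i m) (stDV z i m) \<theta> \<xi> \<eta>
          + d_wedge_d (stV z i m) (stV z i m) \<theta> \<xi> \<eta>))"
      unfolding d_wedge_d_def
      by (rule symplectic_RK_wedge[OF symplectic_space]; (assumption | rule ext_d_RK[OF U])?)
        (use m scheme diff in simp_all)
    moreover have "d_wedge_d (x1q z m) (x1w z m) \<theta> \<xi> \<eta> - d_wedge_d (x0q z m) (x0w z m) \<theta> \<xi> \<eta>
      = \<Delta>x * (\<Sum>i=1..s. b i * (d_wedge_d (stQ z i m) (stDW z i m) \<theta> \<xi> \<eta>
          + d_wedge_d (stW z i m) (stW z i m) \<theta> \<xi> \<eta>))"
      unfolding d_wedge_d_def
      by (rule symplectic_RK_wedge[OF symplectic_space]; (assumption | rule ext_d_RK[OF U])?)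
        (use m scheme diff in simp_all)
    ultimately show ?thesis
      by (simp add: d_wedge_d_def distrib_left sum.distrib)
  qed

  have time: "d_wedge_d (t1q z i) (t1p z i) \<theta> \<xi> \<eta> - d_wedge_d (t0q z i) (t0p z i) \<theta> \<xi> \<eta>
    = - \<Delta>t * (\<Sum>m=1..r. b' m * ?E i m)" if i: "i \<in> {1..s}" for i
  proof -
    have stage_RK: "stQ z i m x = t0q z i x + \<Delta>t * (\<Sum>n=1..r. a' m n * F i n x)"
        "stP z i m x = t0p z i x + \<Delta>t * (\<Sum>n=1..r. a' m n * G i n x)"
      if "m \<in> {1..r}" "x \<in> U" for m x
      unfolding F_def G_def using scheme[OF that(2)] i that(1) by blast+
    have bart1_RK: "bart1q z i x = t0q z i x + \<Delta>t * (\<Sum>n=1..r. b' n * F i n x)"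
        "bart1p z i x = t0p z i x + \<Delta>t * (\<Sum>n=1..r. b' n * G i n x)"
      if "x \<in> U" for x
      unfolding F_def G_def using scheme[OF that] i by blast+
    \<comment> \<open>The stochastic substep leaves the two-form unchanged, so only the
      deterministic Runge-Kutta step contributes.\<close>
    have "d_wedge_d (t1q z i) (t1p z i) \<theta> \<xi> \<eta> = d_wedge_d (bart1q z i) (bart1p z i) \<theta> \<xi> \<eta>"
      unfolding d_wedge_d_def
    proof (rule wedge_symplectic_Euler)
      have "ext_d (t1q z i) \<theta> = (\<lambda>\<xi>. ext_d (bart1q z i) \<theta> \<xi> - ext_d (bart1p z i) \<theta> \<xi> * dW i)"
      proof (rule ext_d_eqI[OF _ U])
        show "((\<lambda>x. bart1q z i x - bart1p z i x * dW i) has_derivative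
            (\<lambda>\<xi>. ext_d (bart1q z i) \<theta> \<xi> - ext_d (bart1p z i) \<theta> \<xi> * dW i)) (at \<theta>)"
          using i by (intro has_derivative_diff has_derivative_mult_left has_derivative_ext_d diff_t)
      qed (use i scheme in simp)
      then show "ext_d (t1q z i) \<theta> \<xi> = ext_d (bart1q z i) \<theta> \<xi> - ext_d (bart1p z i) \<theta> \<xi> * dW i" for \<xi>
        by simp
      have "ext_d (t1p z i) \<theta> = (\<lambda>\<xi>. ext_d (bart1p z i) \<theta> \<xi> + ext_d (t1q z i) \<theta> \<xi> * dW i)"
      proof (rule ext_d_eqI[OF _ U])
        show "((\<lambda>x. bart1p z i x + t1q z i x * dW i) has_derivative
            (\<lambda>\<xi>. ext_d (bart1p z i) \<theta> \<xi> + ext_d (t1q z i) \<theta> \<xi> * dW i)) (at \<theta>)"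
          using i by (intro has_derivative_add has_derivative_mult_left has_derivative_ext_d diff_t)
      qed (use i scheme in blast)
      then show "ext_d (t1p z i) \<theta> \<xi> = ext_d (bart1p z i) \<theta> \<xi> + ext_d (t1q z i) \<theta> \<xi> * dW i" for \<xi>
        by simp
    qed
    moreover have "d_wedge_d (bart1q z i) (bart1p z i) \<theta> \<xi> \<eta> - d_wedge_d (t0q z i) (t0p z i) \<theta> \<xi> \<eta>
      = \<Delta>t * (\<Sum>m=1..r. b' m * (d_wedge_d (stQ z i m) (G i m) \<theta> \<xi> \<eta>
          + d_wedge_d (F i m) (stP z i m) \<theta> \<xi> \<eta>))"
      unfolding d_wedge_d_def
      by (rule symplectic_RK_wedge[OF symplectic_time]; (assumption | rule ext_d_RK[OF U])?)
        (use i in \<open>simp_all add: stage_RK bart1_RK diff_t diff_F diff_G\<close>)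
    moreover have "\<dots> = \<Delta>t * (\<Sum>m=1..r. b' m * (- ?E i m))"
      unfolding F_def[abs_def] G_def[abs_def]
      using i by (intro arg_cong2[where f = "(*)"] sum.cong refl wedge_cubic_terms diff_stage)
    ultimately show ?thesis
      by (simp only: mult_minus_right mult_minus_left sum_negf)
  qed

  \<comment> \<open>Dividing by the step sizes cancels the factors from \<open>time\<close> and
    \<open>space\<close>. Both double sums then carry the weights \<open>b i * b' m\<close> and
    differ only in sign and order of summation.\<close>
  have "(\<Sum>i=1..s. b i / \<Delta>t * (- \<Delta>t * (\<Sum>m=1..r. b' m * ?E i m)))
      + (\<Sum>m=1..r. b' m / \<Delta>x * (\<Delta>x * (\<Sum>i=1..s. b i * ?E i m)))
    = - (\<Sum>i=1..s. \<Sum>m=1..r. b i * b' m * ?E i m) + (\<Sum>m=1..r. \<Sum>i=1..s. b i * b' m * ?E i m)"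
    using \<open>\<Delta>x \<noteq> 0\<close> \<open>\<Delta>t \<noteq> 0\<close> by (simp add: sum_distrib_left sum_negf mult_ac)
  also have "\<dots> = 0"
    by (subst sum.swap) simp
  finally show ?thesis
    by (simp only: space time cong: sum.cong)
qed

theorem theorem4p3:
  fixes s r :: nat
    and a a' :: "nat \<Rightarrow> nat \<Rightarrow> real" and b b' :: "nat \<Rightarrow> real"
    and \<Delta>x \<Delta>t :: real
    and M :: "'w measure" and D :: "real set"
    and Q :: "(real \<Rightarrow> real) \<Rightarrow> real \<Rightarrow> real" and W :: "real \<Rightarrow> real \<Rightarrow> 'w \<Rightarrow> real"
    and c :: "nat \<Rightarrow> real" and \<Delta>W :: "nat \<Rightarrow> 'w \<Rightarrow> real"
    and U :: "'w \<Rightarrow> 'p::real_normed_vector set" and z :: "'w \<Rightarrow> 'p nls_cell"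
  assumes "s \<ge> 1" and "r \<ge> 1" and "\<Delta>x > 0" and "\<Delta>t > 0"
    and c_def: "\<And>i. i \<in> {1..s} \<Longrightarrow> c i = (\<Sum>j=1..s. a i j)"
    and domain: "is_interval D" "{0..\<Delta>x} \<subseteq> D" "\<And>i. i \<in> {1..s} \<Longrightarrow> c i * \<Delta>x \<in> D"
    and noise: "Q_Wiener_process M D Q W"
    and increments: "\<And>i \<omega>. i \<in> {1..s} \<Longrightarrow> \<Delta>W i \<omega> = W (c i * \<Delta>x) \<Delta>t \<omega> - W (c i * \<Delta>x) 0 \<omega>"
    and scheme: "AE \<omega> in M. open (U \<omega>) \<and> differentiable_cell s r (z \<omega>) (U \<omega>) \<and>
      (\<forall>\<theta>\<in>U \<omega>. splitting_RK_method s r a b a' b' \<Delta>x \<Delta>t (\<lambda>i. \<Delta>W i \<omega>) (z \<omega>) \<theta>)"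
    and symplectic_space:
      "\<And>i j. i \<in> {1..s} \<Longrightarrow> j \<in> {1..s} \<Longrightarrow> b i * b j - b i * a i j - b j * a j i = 0"
    and symplectic_time:
      "\<And>m n. m \<in> {1..r} \<Longrightarrow> n \<in> {1..r} \<Longrightarrow> b' m * b' n - b' m * a' m n - b' n * a' n m = 0"
  shows "AE \<omega> in M. \<forall>\<theta>\<in>U \<omega>. \<forall>\<xi> \<eta>.
    (\<Sum>i=1..s. b i / \<Delta>t *
      (d_wedge_d (t1q (z \<omega>) i) (t1p (z \<omega>) i) \<theta> \<xi> \<eta>
       - d_wedge_d (t0q (z \<omega>) i) (t0p (z \<omega>) i) \<theta> \<xi> \<eta>)) +
    (\<Sum>m=1..r. b' m / \<Delta>x *
      (d_wedge_d (x1p (z \<omega>) m) (x1v (z \<omega>) m) \<theta> \<xi> \<eta>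
       - d_wedge_d (x0p (z \<omega>) m) (x0v (z \<omega>) m) \<theta> \<xi> \<eta>
       + d_wedge_d (x1q (z \<omega>) m) (x1w (z \<omega>) m) \<theta> \<xi> \<eta>
       - d_wedge_d (x0q (z \<omega>) m) (x0w (z \<omega>) m) \<theta> \<xi> \<eta>)) = 0"
  \<comment> \<open>The exceptional null set is the one from \<open>scheme\<close>, hence common to
    all \<theta>, \<xi> and \<eta>. Outside it the increments are fixed numbers and the cell
    identity applies.\<close>
  using scheme
  by eventually_elim
    (intro ballI allI splitting_RK_multisymplectic[where a = a and a' = a'] symplectic_space symplectic_time,
      use \<open>\<Delta>x > 0\<close> \<open>\<Delta>t > 0\<close> in auto)

end
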